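(* Let $\mathbb{X}$ be a real normed linear space such that its dual $\mathbb{X}^*$ is strictly convex. Then for any $f, g \in \mathbb{X}^*$, $f \perp_B g$ if and only if there exist sequences $\{x_n\}$, $\{y_n\}$ in $S_{\mathbb{X}}$ such that: (i) $|f(x_n)| \to \|f\|$ and $|f(y_n)| \to \|f\|$ as $n \to \infty$; (ii) $f(x_n)\, g(x_n) \ge 0$ and $f(y_n)\, g(y_n) \le 0$ for all $n \in \mathbb{N}$.
   Context: All normed linear spaces are real. $\mathbb{X}^*$ is the space of bounded linear functionals on $\mathbb{X}$ with the dual norm. $S_{\mathbb{X}} = \{x \in \mathbb{X} : \|x\| = 1\}$. A normed linear space $\mathbb{Z}$ is strictly convex if $\|x+y\| < \|x\| + \|y\|$ for all linearly independent $x, y \in S_{\mathbb{Z}}$. Birkhoff-James orthogonality: $f \perp_B g$ means $\|f\| \le \|f + \lambda g\|$ for all $\lambda \in \mathbb{R}$. *)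

theory Defs
  imports "HOL-Analysis.Analysis"
begin

text \<open>
  The dual of \<open>'a\<close> is the library type \<open>'a \<Rightarrow>\<^sub>L real\<close> of bounded linear functionals, whose
  norm is the operator norm.

  In the next definition, \<open>x \<noteq> y\<close> is needed to express that the pair \<open>(x, y)\<close> is
  linearly independent: for \<open>x = y\<close> the set \<open>{x, y}\<close> is a singleton, which is
  independent as soon as \<open>x \<noteq> 0\<close>.
\<close>

definition strictly_convex :: "'a::real_normed_vector itself \<Rightarrow> bool" where
  "strictly_convex _ \<longleftrightarrow>
     (\<forall>x\<in>sphere (0::'a) 1. \<forall>y\<in>sphere 0 1.
        x \<noteq> y \<and> independent {x, y} \<longrightarrow> norm (x + y) < norm x + norm y)"

definition birkhoff_james_orthogonal :: "'a::real_normed_vector \<Rightarrow> 'a \<Rightarrow> bool"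
  (infix "\<bottom>\<^sub>B" 50) where
  "f \<bottom>\<^sub>B g \<longleftrightarrow> (\<forall>c::real. norm f \<le> norm (f + c *\<^sub>R g))"

end

theory Submission
  imports Defs
begin

text \<open>
  A sequence on which \<open>\<bar>f\<bar>\<close> tends to \<open>norm f\<close> and \<open>f * g\<close> is nonnegative gives
  \<open>norm f \<le> norm (f + c g)\<close> for \<open>c \<ge> 0\<close>; one on which \<open>f * g\<close> is nonpositive gives it for
  \<open>c \<le> 0\<close>. Conversely, strict convexity turns \<open>f \<bottom>\<^sub>B g\<close> into the strict inequality
  \<open>norm f < norm (f + c g)\<close> for \<open>c \<noteq> 0\<close> (unless \<open>f\<close> or \<open>g\<close> vanishes). For small \<open>c > 0\<close> a unit
  vector at which \<open>\<bar>f + c g\<bar>\<close> exceeds \<open>norm f\<close> almost norms \<open>f\<close>, and there \<open>f\<close> and \<open>g\<close> have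
  the same sign; the vectors with opposite signs come from replacing \<open>g\<close> by \<open>- g\<close>.
\<close>

lemma birkhoff_james_orthogonal_minus_right: "f \<bottom>\<^sub>B - g" if "f \<bottom>\<^sub>B g"
  unfolding birkhoff_james_orthogonal_def
proof
  fix c :: real
  have "norm f \<le> norm (f + (- c) *\<^sub>R g)"
    using that unfolding birkhoff_james_orthogonal_def by blast
  then show "norm f \<le> norm (f + c *\<^sub>R - g)"
    by simp
qed

text \<open>If equality held, \<open>f\<close> and \<open>f + c *\<^sub>R g\<close> would be
  distinct points of one sphere. Orthogonality keeps their midpoint
  \<open>f + (c / 2) *\<^sub>R g\<close> from entering the open ball, which strict convexity
  forbids.\<close>

lemma strictly_convex_orthogonal_norm_less:
  fixes f g :: "'a::real_normed_vector"
  assumes sc: "strictly_convex TYPE('a)" and orth: "f \<bottom>\<^sub>B g"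
    and nz: "f \<noteq> 0" "g \<noteq> 0" "c \<noteq> 0"
  shows "norm f < norm (f + c *\<^sub>R g)"
proof (rule ccontr)
  have le: "norm f \<le> norm (f + b *\<^sub>R g)" for b
    using orth unfolding birkhoff_james_orthogonal_def by blast
  assume "\<not> norm f < norm (f + c *\<^sub>R g)"
  with le[of c] have eq: "norm (f + c *\<^sub>R g) = norm f"
    by simp
  define r where "r = norm f"
  have r: "r > 0"
    using nz by (simp add: r_def)
  define u where "u = f /\<^sub>R r"
  define v where "v = (f + c *\<^sub>R g) /\<^sub>R r"
  have unit: "norm u = 1" "norm v = 1"
    using r eq by (simp_all add: u_def v_def r_def)
  have "u \<noteq> v"
    using nz r by (simp add: u_def v_def)
  have "r *\<^sub>R (u + v) = 2 *\<^sub>R (f + (c / 2) *\<^sub>R g)"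
    using r by (simp add: u_def v_def scaleR_add_right scaleR_2)
  then have "norm (r *\<^sub>R (u + v)) = norm (2 *\<^sub>R (f + (c / 2) *\<^sub>R g))"
    by (rule arg_cong)
  then have sum: "r * norm (u + v) = 2 * norm (f + (c / 2) *\<^sub>R g)"
    using r by (simp only: norm_scaleR)
  have ge: "norm (u + v) \<ge> 2"
  proof -
    have "r * 2 \<le> r * norm (u + v)"
      using le[of "c / 2"] unfolding sum by (simp add: r_def)
    with r show ?thesis
      by simp
  qed
  \<comment> \<open>Dependent unit vectors agree up to sign, and \<open>v = - u\<close> would make
    \<open>u + v\<close> vanish, against \<open>ge\<close>.\<close>
  have "independent {u, v}"
  proof (rule ccontr)
    assume "\<not> independent {u, v}"
    moreover have "u \<noteq> 0"
      using unit by auto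
    ultimately have "v \<in> span {u}"
      using independent_insertI[of v "{u}"] by (auto simp: insert_commute)
    then obtain a where a: "v = a *\<^sub>R u"
      by (auto simp: span_singleton)
    then have "\<bar>a\<bar> = 1"
      using unit by simp
    then have "v = u \<or> v = - u"
      using a by (auto simp: abs_if split: if_splits)
    with \<open>u \<noteq> v\<close> ge show False
      by auto
  qed
  with sc \<open>u \<noteq> v\<close> unit have "norm (u + v) < norm u + norm v"
    unfolding strictly_convex_def by simp
  with unit ge show False
    by simp
qed

text \<open>By homogeneity a bound on the unit sphere bounds the operator norm. The nonzero vector
  makes the sphere nonempty, so that such a bound is nonnegative; on the zero space any negative
  \<open>r\<close> would be a counterexample.\<close>

lemma blinfun_exists_unit_vector:
  fixes h :: "'a::real_normed_vector \<Rightarrow>\<^sub>L 'b::real_normed_vector"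
  assumes "\<exists>x::'a. x \<noteq> 0" and "r < norm h"
  shows "\<exists>x. norm x = 1 \<and> r < norm (h x)"
proof (rule ccontr)
  assume "\<not> ?thesis"
  then have bound: "norm (h x) \<le> r" if "norm x = 1" for x
    using that by force
  obtain z :: 'a where "z \<noteq> 0"
    using assms by blast
  then have "0 \<le> r"
    using order_trans[OF norm_ge_zero bound, of "sgn z"] by (simp add: norm_sgn)
  moreover have "norm (h x) \<le> r * norm x" for x
  proof (cases "x = 0")
    case False
    then show ?thesis
      using bound[of "sgn x"]
      by (simp add: norm_sgn sgn_div_norm blinfun.scaleR_right divide_simps)
  qed simp
  ultimately have "norm h \<le> r"
    by (rule norm_blinfun_bound)
  with assms show False
    by simp
qed

lemma orthogonal_almost_norming:
  fixes f g :: "'a::real_normed_vector \<Rightarrow>\<^sub>L real"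
  assumes nontriv: "\<exists>x::'a. x \<noteq> 0" and sc: "strictly_convex TYPE('a \<Rightarrow>\<^sub>L real)"
    and orth: "f \<bottom>\<^sub>B g" and "\<epsilon> > 0"
  shows "\<exists>x. norm x = 1 \<and> norm f - \<epsilon> < \<bar>f x\<bar> \<and> f x * g x \<ge> 0"
proof (cases "f = 0 \<or> g = 0")
  \<comment> \<open>Here \<open>f x * g x = 0\<close> for every \<open>x\<close>, so any almost
    norming unit vector will do.\<close>
  case True
  then show ?thesis
    using blinfun_exists_unit_vector[OF nontriv, of "norm f - \<epsilon>" f] \<open>\<epsilon> > 0\<close> by auto
next
  case False
  \<comment> \<open>The perturbation \<open>c * g x\<close> is at most \<epsilon> in modulus, so
    \<open>f\<close> alone is still almost normed at \<open>x\<close>. It is also at most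
    \<open>norm f\<close>: were the signs of \<open>f x\<close> and \<open>c * g x\<close> strictly
    opposite, their sum would have modulus at most the larger of the two moduli, hence at most
    \<open>norm f\<close>.\<close>
  define c where "c = min \<epsilon> (norm f) / norm g"
  have c: "c > 0" "c * norm g \<le> \<epsilon>" "c * norm g \<le> norm f"
    using False \<open>\<epsilon> > 0\<close> by (auto simp: c_def)
  have "norm f < norm (f + c *\<^sub>R g)"
    using strictly_convex_orthogonal_norm_less[OF sc orth] False c by simp
  then obtain x where x: "norm x = 1" "norm f < \<bar>f x + c * g x\<bar>"
    using blinfun_exists_unit_vector[OF nontriv, of "norm f" "f + c *\<^sub>R g"]
    by (auto simp: blinfun.bilinear_simps)
  have "\<bar>f x\<bar> \<le> norm f" "\<bar>g x\<bar> \<le> norm g"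
    using norm_blinfun[of f x] norm_blinfun[of g x] x by auto
  moreover from this(2) have "\<bar>c * g x\<bar> \<le> c * norm g"
    using c by (simp add: abs_mult)
  ultimately have "norm f - \<epsilon> < \<bar>f x\<bar>"
    and "f x \<ge> 0 \<and> c * g x \<ge> 0 \<or> f x \<le> 0 \<and> c * g x \<le> 0"
    using c x by linarith+
  then have "f x * g x \<ge> 0"
    using c by (auto simp: zero_le_mult_iff mult_le_0_iff)
  with x \<open>norm f - \<epsilon> < \<bar>f x\<bar>\<close> show ?thesis
    by blast
qed

lemma orthogonal_norming_sequence:
  fixes f g :: "'a::real_normed_vector \<Rightarrow>\<^sub>L real"
  assumes "\<exists>x::'a. x \<noteq> 0" and "strictly_convex TYPE('a \<Rightarrow>\<^sub>L real)" and "f \<bottom>\<^sub>B g"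
  obtains x :: "nat \<Rightarrow> 'a" where "\<And>n. norm (x n) = 1"
    and "(\<lambda>n. \<bar>f (x n)\<bar>) \<longlonglongrightarrow> norm f" and "\<And>n. f (x n) * g (x n) \<ge> 0"
proof -
  have "\<exists>x. norm x = 1 \<and> norm f - inverse (real (Suc n)) < \<bar>f x\<bar> \<and> f x * g x \<ge> 0" for n :: nat
    using orthogonal_almost_norming[OF assms, of "inverse (real (Suc n))"] by simp
  then obtain x where x: "\<And>n. norm (x n) = 1"
    "\<And>n::nat. norm f - inverse (real (Suc n)) < \<bar>f (x n)\<bar>" "\<And>n. f (x n) * g (x n) \<ge> 0"
    by metis
  have lim: "(\<lambda>n. norm f - inverse (real (Suc n))) \<longlonglongrightarrow> norm f"
    using tendsto_diff[OF tendsto_const LIMSEQ_inverse_real_of_nat] by simp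
  have "\<bar>f (x n)\<bar> \<le> norm f" for n
    using norm_blinfun[of f "x n"] x(1) by simp
  then have "(\<lambda>n. \<bar>f (x n)\<bar>) \<longlonglongrightarrow> norm f"
    using x(2) by (intro real_tendsto_sandwich[OF _ _ lim tendsto_const] always_eventually)
      (auto intro: less_imp_le)
  with x that show ?thesis
    by blast
qed

text \<open>When the signs agree there is no cancellation, so adding \<open>c * g (x n)\<close>
  cannot decrease the modulus of \<open>f (x n)\<close>. Keeping \<open>c\<close> inside the sign
  condition lets the lemma serve both signs of \<open>c\<close>.\<close>

lemma norming_sequence_norm_le:
  fixes f g :: "'a::real_normed_vector \<Rightarrow>\<^sub>L real"
  assumes unit: "\<And>n. norm (x n) = 1" and lim: "(\<lambda>n. \<bar>f (x n)\<bar>) \<longlonglongrightarrow> norm f"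
    and sign: "\<And>n. f (x n) * (c * g (x n)) \<ge> 0"
  shows "norm f \<le> norm (f + c *\<^sub>R g)"
proof (rule LIMSEQ_le_const2[OF lim], intro exI allI impI)
  fix n
  have "\<bar>f (x n)\<bar> \<le> \<bar>f (x n) + c * g (x n)\<bar>"
    using sign[of n] by (auto simp: zero_le_mult_iff)
  also have "\<dots> \<le> norm (f + c *\<^sub>R g)"
    using norm_blinfun[of "f + c *\<^sub>R g" "x n"] unit by (simp add: blinfun.bilinear_simps)
  finally show "\<bar>f (x n)\<bar> \<le> norm (f + c *\<^sub>R g)" .
qed

theorem theorem2p6:
  fixes f g :: "'a::real_normed_vector \<Rightarrow>\<^sub>L real"
  assumes "\<exists>x::'a. x \<noteq> 0"
    and "strictly_convex TYPE('a \<Rightarrow>\<^sub>L real)"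
  shows "f \<bottom>\<^sub>B g \<longleftrightarrow>
    (\<exists>x y :: nat \<Rightarrow> 'a.
       (\<forall>n. x n \<in> sphere 0 1) \<and> (\<forall>n. y n \<in> sphere 0 1) \<and>
       (\<lambda>n. \<bar>blinfun_apply f (x n)\<bar>) \<longlonglongrightarrow> norm f \<and>
       (\<lambda>n. \<bar>blinfun_apply f (y n)\<bar>) \<longlonglongrightarrow> norm f \<and>
       (\<forall>n. blinfun_apply f (x n) * blinfun_apply g (x n) \<ge> 0) \<and>
       (\<forall>n. blinfun_apply f (y n) * blinfun_apply g (y n) \<le> 0))"
    (is "_ \<longleftrightarrow> ?R")
proof
  assume orth: "f \<bottom>\<^sub>B g"
  obtain x where "\<And>n. norm (x n) = 1" "(\<lambda>n. \<bar>f (x n)\<bar>) \<longlonglongrightarrow> norm f"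
    "\<And>n. f (x n) * g (x n) \<ge> 0"
    using orthogonal_norming_sequence[OF assms orth] by blast
  moreover obtain y where "\<And>n. norm (y n) = 1" "(\<lambda>n. \<bar>f (y n)\<bar>) \<longlonglongrightarrow> norm f"
    "\<And>n. f (y n) * (- g) (y n) \<ge> 0"
    using orthogonal_norming_sequence[OF assms birkhoff_james_orthogonal_minus_right[OF orth]]
    by blast
  ultimately show ?R
    by (intro exI[of _ x] exI[of _ y]) (simp add: blinfun.minus_left)
next
  assume ?R
  then obtain x y where
    x: "\<And>n. norm (x n) = 1" "(\<lambda>n. \<bar>f (x n)\<bar>) \<longlonglongrightarrow> norm f" "\<And>n. f (x n) * g (x n) \<ge> 0" and
    y: "\<And>n. norm (y n) = 1" "(\<lambda>n. \<bar>f (y n)\<bar>) \<longlonglongrightarrow> norm f" "\<And>n. f (y n) * g (y n) \<le> 0"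
    by auto
  show "f \<bottom>\<^sub>B g"
    unfolding birkhoff_james_orthogonal_def
  proof
    fix c :: real
    show "norm f \<le> norm (f + c *\<^sub>R g)"
    \<comment> \<open>The sign of \<open>c\<close> decides along which of the two sequences
      \<open>f\<close> and \<open>c *\<^sub>R g\<close> have a nonnegative product.\<close>
    proof (cases "c \<ge> 0")
      case True
      then have "f (x n) * (c * g (x n)) \<ge> 0" for n
        using mult_nonneg_nonneg[OF True x(3)[of n]] by (simp add: mult.left_commute)
      then show ?thesis
        by (rule norming_sequence_norm_le[OF x(1,2)])
    next
      case False
      then have "f (y n) * (c * g (y n)) \<ge> 0" for n
        using mult_nonpos_nonpos[of c, OF _ y(3)[of n]] by (simp add: mult.left_commute)
      then show ?thesis
        by (rule norming_sequence_norm_le[OF y(1,2)])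
    qed
  qed
qed

end
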